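(* Let $m\in V$. (i) If $m\equiv 2\pmod 4$ or $m\equiv 4\pmod 8$, then $m<N_3(m)<2m$ and $2m<N_2(m)<4m$. (ii) There exist infinitely many $m\in V$ such that $N_2(m)/N_3(m)=2$. Further, if $m\equiv 2\pmod 4$, then $2\le N_2(m)/N_3(m)\le 3$. (iii) Each of $N_2$ and $N_3$ contains an infinite geometric progression.
   Context: $\phi$ is Euler's totient function, $V=\phi(\mathbb{N})$, $\phi^{-1}(m)=\{x\in\mathbb{N}\colon\phi(x)=m\}$. For $m\in V$: $N_2(m)=\max\phi^{-1}(m)$, $N_3(m)=\min\phi^{-1}(m)$, and $N_i=\{N_i(m)\colon m\in V\}$ for $i=2,3$. *)

theory Defs
  imports "HOL-Number_Theory.Number_Theory"
begin

text \<open>Here \<open>\<nat>\<close> consists of the positive integers; the library convention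
  \<open>totient 0 = 0\<close> is therefore excluded explicitly.\<close>

definition totient_values :: "nat set" where
  "totient_values = totient ` {n. 0 < n}"

definition totient_fibre :: "nat \<Rightarrow> nat set" where
  "totient_fibre m = {x. 0 < x \<and> totient x = m}"

text \<open>The fibres of the totient function are finite, and they are nonempty exactly over
  \<open>totient_values\<close>; only there are the following two functions meaningful.\<close>

definition N2 :: "nat \<Rightarrow> nat" where
  "N2 m = Max (totient_fibre m)"

definition N3 :: "nat \<Rightarrow> nat" where
  "N3 m = Min (totient_fibre m)"

text \<open>A geometric progression in the positive integers with infinitely many terms has a positive
  integer ratio, different from 1.\<close>

definition contains_infinite_geometric_progression :: "nat set \<Rightarrow> bool" where
  "contains_infinite_geometric_progression S \<longleftrightarrow>
     (\<exists>a r :: nat. 0 < a \<and> 1 < r \<and> (\<forall>k :: nat. a * r ^ k \<in> S))"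

end

theory Submission
  imports Defs
begin

text \<open>An odd number with \<open>r\<close> distinct prime factors has totient divisible by \<open>2 ^ r\<close>. Hence if
  \<open>m \<equiv> 2 (mod 4)\<close> or \<open>m \<equiv> 4 (mod 8)\<close>, the odd part of each preimage \<open>x\<close> of \<open>m\<close> has at most one,
  respectively two, prime factors, which bounds \<open>x / m\<close>; moreover each such fibre contains an odd
  number \<open>y\<close>, and then also \<open>2 * y\<close>. For the infinite families take \<open>m = 2 * 3 ^ (6 * t + 7)\<close>:
  as \<open>7\<close> divides \<open>m + 1\<close>, the number \<open>m + 1\<close> is not prime and the fibre of \<open>m\<close> consists of
  \<open>3 ^ (6 * t + 8)\<close> and its double.\<close>

section \<open>Splitting off a prime power\<close>

lemma prime_part_decomposition:
  fixes n p :: nat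
  assumes "prime p" "n > 0" "p dvd n"
  obtains k z where "n = p ^ Suc k * z" "\<not> p dvd z" "totient n = p ^ k * (p - 1) * totient z"
proof -
  have nu: "\<not> is_unit p" using assms(1) by auto
  obtain z where z: "n = p ^ multiplicity p n * z" "\<not> p dvd z"
    using multiplicity_decompose'[of n p] assms(2) nu by auto
  have "multiplicity p n > 0"
    using assms nu by (simp add: multiplicity_gt_zero_iff)
  then obtain k where k: "multiplicity p n = Suc k"
    using gr0_implies_Suc by blast
  have "coprime (p ^ Suc k) z"
    using z(2) assms(1) by (simp add: prime_imp_coprime del: power_Suc)
  then have "totient (p ^ Suc k * z) = p ^ k * (p - 1) * totient z"
    using assms(1) by (simp add: totient_mult_coprime totient_prime_power_Suc del: power_Suc)
  then show thesis using that z k by metis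
qed

lemma odd_prime_part_decomposition:
  fixes y :: nat
  assumes "odd y" "y \<noteq> 1"
  obtains p k z where "prime p" "odd p" "odd z" "y = p ^ Suc k * z" "\<not> p dvd z"
    "totient y = p ^ k * (p - 1) * totient z"
proof -
  obtain p where p: "prime p" "p dvd y"
    using assms(2) prime_factor_nat by blast
  have "y > 0" using assms(1) by (cases y) auto
  from prime_part_decomposition[OF p(1) this p(2)] obtain k z where
    "y = p ^ Suc k * z" "\<not> p dvd z" "totient y = p ^ k * (p - 1) * totient z" .
  with assms p that show thesis by (metis even_mult_iff dvd_trans)
qed

lemma even_part_decomposition:
  fixes x :: nat
  assumes "x > 0" "even x"
  obtains k y where "odd y" "x = 2 ^ Suc k * y" "totient x = 2 ^ k * totient y"
proof -
  from prime_part_decomposition[OF two_is_prime_nat assms] obtain k y where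
    "x = 2 ^ Suc k * y" "odd y" "totient x = 2 ^ k * (2 - 1) * totient y" .
  then show thesis by (intro that[of y k]) simp_all
qed

section \<open>Bounds on a number by a multiple of its totient\<close>

lemma odd_prime_ge_3:
  fixes p :: nat
  assumes "prime p" "odd p"
  shows "p \<ge> 3"
  using assms prime_ge_2_nat[of p] by (cases "p = 2") auto

lemma totient_odd_even:
  fixes z :: nat
  assumes "odd z" "z \<noteq> 1"
  shows "even (totient z)"
proof -
  have "z > 2" using assms by presburger
  then show ?thesis by (rule totient_even)
qed

text \<open>Each odd prime \<open>p\<close> dividing \<open>y\<close> contributes an even factor
  \<open>p - 1\<close> to the totient, so two of them would already give a factor 4.\<close>

lemma odd_totient_not_dvd_4:
  fixes y :: nat
  assumes "odd y" "\<not> 4 dvd totient y"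
  shows "y = 1 \<or> (\<exists>p k. prime p \<and> odd p \<and> y = p ^ Suc k \<and> totient y = p ^ k * (p - 1))"
proof (cases "y = 1")
  case False
  from odd_prime_part_decomposition[OF assms(1) this] obtain p k z where
    *: "prime p" "odd p" "odd z" "y = p ^ Suc k * z" "totient y = p ^ k * (p - 1) * totient z" .
  have "z = 1"
  proof (rule ccontr)
    assume "z \<noteq> 1"
    then have "2 * 2 dvd (p - 1) * totient z"
      using * totient_odd_even by (intro mult_dvd_mono) auto
    then have "4 dvd totient y" using *(5) by (simp add: mult.assoc)
    with assms(2) show False by simp
  qed
  with * show ?thesis by auto
qed auto

text \<open>For a power of a single prime \<open>p\<close> the quotient by the totient is p / (p -
  1), which is largest at p = 3.\<close>

lemma odd_le_three_halves_totient:
  fixes y :: nat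
  assumes "odd y" "\<not> 4 dvd totient y"
  shows "2 * y \<le> 3 * totient y"
  using odd_totient_not_dvd_4[OF assms]
proof (elim disjE exE conjE)
  fix p k assume *: "prime p" "odd p" "y = p ^ Suc k" "totient y = p ^ k * (p - 1)"
  have "2 * p \<le> 3 * (p - 1)" using odd_prime_ge_3[OF *(1,2)] by simp
  then have "p ^ k * (2 * p) \<le> p ^ k * (3 * (p - 1))" by (rule mult_left_mono) simp
  then show ?thesis unfolding *(4) unfolding *(3) by (simp add: mult_ac)
qed simp

text \<open>Removing one prime power from \<open>y\<close> removes a factor 2 from the totient, so
  the rest \<open>z\<close> is 1 or a prime power. With two distinct odd primes the quotient is at
  most 3/2 * 5/4 = 15/8.\<close>

lemma odd_less_twice_totient:
  fixes y :: nat
  assumes "odd y" "\<not> 8 dvd totient y"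
  shows "y < 2 * totient y"
proof (cases "y = 1")
  case False
  from odd_prime_part_decomposition[OF assms(1) this] obtain p k z where
    *: "prime p" "odd p" "odd z" "y = p ^ Suc k * z" "\<not> p dvd z"
       "totient y = p ^ k * (p - 1) * totient z" .
  have p3: "p \<ge> 3" by (rule odd_prime_ge_3) fact+
  have "\<not> 4 dvd totient z"
  proof
    assume "4 dvd totient z"
    then have "2 * 4 dvd (p - 1) * totient z"
      using *(2) by (intro mult_dvd_mono) auto
    with assms(2) *(6) show False by (simp add: mult.assoc)
  qed
  from odd_totient_not_dvd_4[OF *(3) this] show ?thesis
  proof (elim disjE exE conjE)
    assume "z = 1"
    have "p ^ k * p < p ^ k * (2 * (p - 1))" using p3 by simp
    with \<open>z = 1\<close> show ?thesis unfolding *(6) unfolding *(4) by (simp add: mult_ac)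
  next
    fix q l assume q: "prime q" "odd q" "z = q ^ Suc l" "totient z = q ^ l * (q - 1)"
    have q3: "q \<ge> 3" by (rule odd_prime_ge_3) fact+
    have "p \<noteq> q" using *(5) q(3) by auto
    have "p * q < 2 * ((p - 1) * (q - 1))"
    proof -
      \<comment> \<open>After this substitution, twice (p - 1)(q - 1) minus pq is a + b + ab - 1.
        Distinctness is essential: p = q = 3 would give 9 against 8. Parity of \<open>a\<close> and
        \<open>b\<close> then yields a + b at least 2.\<close>
      obtain a b where ab: "p = 3 + a" "q = 3 + b" using p3 q3 le_Suc_ex by metis
      have "a \<noteq> 0 \<or> b \<noteq> 0" using ab \<open>p \<noteq> q\<close> by auto
      moreover have "even a" "even b" using ab *(2) q(2) by auto
      ultimately have "a + b \<ge> 2" by presburger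
      then show ?thesis unfolding ab by (simp add: algebra_simps)
    qed
    then have "p ^ k * q ^ l * (p * q) < p ^ k * q ^ l * (2 * ((p - 1) * (q - 1)))"
      using p3 q3 by simp
    then show ?thesis unfolding *(6) q(4) unfolding *(4) q(3) by (simp add: mult_ac)
  qed
qed simp

text \<open>The power of 2 in an even number contributes exactly a factor 2 to the quotient, so the
  bound for the odd part doubles.\<close>

lemma less_four_times_totient:
  fixes x :: nat
  assumes "x > 0" "\<not> 8 dvd totient x"
  shows "x < 4 * totient x"
proof (cases "even x")
  case True
  from even_part_decomposition[OF assms(1) this] obtain k y where
    *: "odd y" "x = 2 ^ Suc k * y" "totient x = 2 ^ k * totient y" .
  have "y < 2 * totient y"
    using * assms(2) by (intro odd_less_twice_totient) auto
  then show ?thesis unfolding *(3) unfolding *(2) by simp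
next
  case False
  from odd_less_twice_totient[OF this assms(2)] show ?thesis by simp
qed

lemma le_three_times_totient:
  fixes x :: nat
  assumes "x > 0" "\<not> 4 dvd totient x"
  shows "x \<le> 3 * totient x"
proof (cases "even x")
  case True
  from even_part_decomposition[OF assms(1) this] obtain k y where
    *: "odd y" "x = 2 ^ Suc k * y" "totient x = 2 ^ k * totient y" .
  have "2 * y \<le> 3 * totient y"
    using * assms(2) by (intro odd_le_three_halves_totient) auto
  then have "2 ^ k * (2 * y) \<le> 2 ^ k * (3 * totient y)" by (rule mult_left_mono) simp
  then show ?thesis unfolding *(3) unfolding *(2) by (simp add: mult_ac)
next
  case False
  from odd_le_three_halves_totient[OF this assms(2)] show ?thesis by simp
qed

text \<open>This serves to show that \<open>N3 m\<close> is odd, once it is known to lie below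
  \<open>2 * m\<close>.\<close>

lemma even_ge_twice_totient:
  fixes x :: nat
  assumes "x > 0" "even x"
  shows "2 * totient x \<le> x"
proof -
  from even_part_decomposition[OF assms] obtain k y where
    *: "odd y" "x = 2 ^ Suc k * y" "totient x = 2 ^ k * totient y" .
  have "2 ^ Suc k * totient y \<le> 2 ^ Suc k * y"
    by (intro mult_left_mono totient_le) simp
  then show ?thesis unfolding *(3) unfolding *(2) by simp
qed

section \<open>Odd members of the fibres\<close>

lemma totient_3: "totient 3 = 2"
  and totient_5: "totient 5 = 4"
  and totient_7: "totient 7 = 6"
  by (simp_all add: totient_prime)

text \<open>The power of 2 in an even \<open>x\<close> has totient \<open>2 ^ k\<close>, and the
  idea is to trade it for odd factors with the same totient. Since 8 does not divide
  \<open>totient x\<close>, only k = 0, 1, 2 occur; for k = 0 the odd part itself works.\<close>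

lemma exists_odd_same_totient:
  fixes x :: nat
  assumes "x > 0" "even (totient x)" "\<not> 8 dvd totient x"
  shows "\<exists>y. odd y \<and> totient y = totient x"
proof (cases "even x")
  case True
  from even_part_decomposition[OF assms(1) this] obtain k y where
    *: "odd y" "x = 2 ^ Suc k * y" "totient x = 2 ^ k * totient y" .
  have "k < 3"
  proof (rule ccontr)
    assume "\<not> k < 3"
    then have "2 ^ 3 dvd (2 :: nat) ^ k" by (intro le_imp_power_dvd) simp
    then show False using assms(3) *(3) by simp
  qed
  then consider "k = 0" | "k = 1" | "k = 2" by linarith
  then show ?thesis
  proof cases
    case 1
    then show ?thesis using * by auto
  next
    case 2
    have "\<not> 4 dvd totient y"
    proof
      assume "4 dvd totient y"
      then have "2 * 4 dvd 2 * totient y" by (intro mult_dvd_mono) auto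
      then show False using 2 *(3) assms(3) by simp
    qed
    from odd_totient_not_dvd_4[OF *(1) this] show ?thesis
    proof (elim disjE exE conjE)
      assume "y = 1"
      then have "totient x = 2" using *(3) 2 by simp
      then show ?thesis using totient_3 by (intro exI[of _ 3]) simp
    next
      fix p l assume p: "prime p" "odd p" "y = p ^ Suc l" "totient y = p ^ l * (p - 1)"
      \<comment> \<open>Here x = 4y, and the factor 4 can be replaced by 3, also of totient 2,
        unless 3 divides \<open>y\<close>.\<close>
      show ?thesis
      proof (cases "p = 3")
        case False
        then have "coprime 3 p" using p(1) by (simp add: primes_coprime)
        then have "coprime 3 y" using p(3) by simp
        then have "totient (3 * y) = totient x"
          using *(3) 2 totient_3 by (simp add: totient_mult_coprime)
        then show ?thesis using *(1) by (intro exI[of _ "3 * y"]) simp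
      next
        case p3: True
        \<comment> \<open>Now \<open>y\<close> is a power of 3. The number 12 is traded for 5, and 4
          * 3^(i+2) for 7 * 3^(i+1): both of the latter have totient 12 * 3^i.\<close>
        show ?thesis
        proof (cases l)
          case 0
          then have "totient x = 4" using p3 p(4) *(3) 2 by simp
          then show ?thesis using totient_5 by (intro exI[of _ 5]) simp
        next
          case (Suc i)
          have "coprime 7 (3 :: nat)" by (intro primes_coprime) auto
          then have "coprime 7 ((3 :: nat) ^ Suc i)" by simp
          then have "totient (7 * 3 ^ Suc i) = 6 * (3 ^ i * 2)"
            using totient_7 totient_prime_power_Suc[of 3 i]
            by (simp add: totient_mult_coprime del: power_Suc)
          also have "\<dots> = totient x" using p3 p(4) *(3) 2 Suc by simp
          finally show ?thesis by (intro exI[of _ "7 * 3 ^ Suc i"]) simp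
        qed
      qed
    qed
  next
    case 3
    \<comment> \<open>The power of 2 alone gives a factor 4, so any odd prime in \<open>y\<close>
      would produce 8. Only x = 8 remains, which is traded for 5.\<close>
    have "y = 1"
    proof (rule ccontr)
      assume "y \<noteq> 1"
      then have "4 * 2 dvd 4 * totient y"
        using totient_odd_even[OF *(1)] by (intro mult_dvd_mono) auto
      then show False using 3 *(3) assms(3) by simp
    qed
    then have "totient x = 4" using 3 *(3) by simp
    then show ?thesis using totient_5 by (intro exI[of _ 5]) simp
  qed
qed auto

section \<open>The extremes of a fibre\<close>

lemma finite_totient_fibre:
  assumes "\<not> 8 dvd m"
  shows "finite (totient_fibre m)"
proof (rule finite_subset)
  show "totient_fibre m \<subseteq> {..<4 * m}"
  proof
    fix x assume "x \<in> totient_fibre m"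
    then have "x > 0" "totient x = m" by (simp_all add: totient_fibre_def)
    with less_four_times_totient[of x] assms show "x \<in> {..<4 * m}" by simp
  qed
qed simp

context
  fixes m :: nat
  assumes m_value: "m \<in> totient_values" and m_not_dvd: "\<not> 8 dvd m"
begin

lemma fibre_nonempty: "totient_fibre m \<noteq> {}"
  using m_value by (auto simp: totient_values_def totient_fibre_def)

lemma N2_in_fibre: "N2 m \<in> totient_fibre m"
  unfolding N2_def by (intro Max_in finite_totient_fibre m_not_dvd fibre_nonempty)

lemma N3_in_fibre: "N3 m \<in> totient_fibre m"
  unfolding N3_def by (intro Min_in finite_totient_fibre m_not_dvd fibre_nonempty)

lemma N2_ge: "x \<in> totient_fibre m \<Longrightarrow> x \<le> N2 m"
  unfolding N2_def by (intro Max_ge finite_totient_fibre m_not_dvd)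

lemma N3_le: "x \<in> totient_fibre m \<Longrightarrow> N3 m \<le> x"
  unfolding N3_def by (intro Min_le finite_totient_fibre m_not_dvd)

lemma N_bounds:
  assumes "even m"
  shows "m < N3 m" "N3 m < 2 * m" "2 * m < N2 m" "N2 m < 4 * m"
proof -
  \<comment> \<open>Evenness of \<open>m\<close> excludes x = 1, the only positive number that does
    not exceed its totient.\<close>
  have gt: "m < x" if "x \<in> totient_fibre m" for x
  proof -
    have "x \<noteq> 1" "x \<noteq> 0" "totient x = m"
      using that assms by (auto simp: totient_fibre_def)
    then show ?thesis using totient_less[of x] by auto
  qed
  show "m < N3 m" by (intro gt N3_in_fibre)
  obtain x where "x > 0" "totient x = m"
    using m_value by (auto simp: totient_values_def)
  \<comment> \<open>One odd \<open>y\<close> settles both middle bounds: \<open>y\<close> itself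
    lies below 2m, and its double, in the same fibre, lies above 2m because \<open>y\<close> exceeds
    \<open>m\<close>.\<close>
  with exists_odd_same_totient[of x] assms m_not_dvd obtain y where
    y: "odd y" "totient y = m" by auto
  have "y > 0" using y(1) by (cases y) auto
  then have fib: "y \<in> totient_fibre m" "2 * y \<in> totient_fibre m"
    using y totient_double by (auto simp: totient_fibre_def)
  have "y < 2 * m" using odd_less_twice_totient y m_not_dvd by blast
  then show "N3 m < 2 * m" using N3_le[OF fib(1)] by simp
  show "2 * m < N2 m" using gt[OF fib(1)] N2_ge[OF fib(2)] by simp
  show "N2 m < 4 * m"
    using N2_in_fibre less_four_times_totient[of "N2 m"] m_not_dvd by (auto simp: totient_fibre_def)
qed

text \<open>Even members of the fibre are at least 2m, while \<open>N3 m\<close> is smaller; so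
  \<open>N3 m\<close> is odd and its double is again in the fibre.\<close>

lemma N2_ge_twice_N3:
  assumes "even m"
  shows "2 * N3 m \<le> N2 m"
proof -
  have N3: "N3 m > 0" "totient (N3 m) = m"
    using N3_in_fibre by (auto simp: totient_fibre_def)
  have "odd (N3 m)"
    using even_ge_twice_totient[of "N3 m"] N3 N_bounds(2)[OF assms] by linarith
  then show ?thesis
    using N3 totient_double by (intro N2_ge) (simp add: totient_fibre_def)
qed

end

section \<open>The infinite family and its geometric progressions\<close>

lemma fibre_two_times_power_three:
  "totient_fibre (2 * 3 ^ (6 * t + 7)) = {3 ^ (6 * t + 8), 2 * 3 ^ (6 * t + 8)}"
proof -
  define j where "j = 6 * t + 7"
  define m :: nat where "m = 2 * 3 ^ j"
  have "odd ((3 :: nat) ^ j)" by simp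
  then have m4: "\<not> 4 dvd m" unfolding m_def by presburger
  have m2: "m > 2"
    using one_less_power[of "3 :: nat" j] by (simp add: m_def j_def del: one_less_power)
  have not_prime: "\<not> prime (m + 1)"
  proof
    assume "prime (m + 1)"
    \<comment> \<open>By Fermat's little theorem, steps of 6 in the exponent do not change
      \<open>m\<close> modulo 7, and at t = 0 one has 2 * 3^7 + 1 = 4375 = 7 * 625.\<close>
    have "[(3 ^ 6) ^ t = 1 ^ t] (mod (7 :: nat))"
      by (intro cong_pow) (simp add: cong_def)
    then have "[2 * (3 ^ 7 * (3 ^ 6) ^ t) + 1 = 2 * (3 ^ 7 * 1 ^ t) + 1] (mod (7 :: nat))"
      by (intro cong_add cong_mult cong_refl)
    then have "7 dvd 2 * (3 ^ 7 * (3 ^ 6) ^ t) + (1 :: nat)"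
      by (simp add: cong_def mod_eq_0_iff_dvd)
    also have "2 * (3 ^ 7 * (3 ^ 6) ^ t) + 1 = m + 1"
      unfolding m_def j_def power_add power_mult by (simp only: mult.commute)
    finally have "7 = m + 1"
      using \<open>prime (m + 1)\<close> by (intro primes_dvd_imp_eq) simp_all
    moreover have "(3 :: nat) ^ 2 \<le> 3 ^ j"
      unfolding j_def by (intro power_increasing) auto
    ultimately show False by (simp add: m_def)
  qed
  have odd_case: "y = 3 ^ Suc j" if "odd y" "totient y = m" for y
  proof -
    have "y \<noteq> 1" using that m2 by auto
    with odd_totient_not_dvd_4[of y] that m4 obtain p k where
      p: "prime p" "odd p" "y = p ^ Suc k" "m = p ^ k * (p - 1)" by auto
    \<comment> \<open>If k = 0, then p = m + 1 would be prime; otherwise \<open>p\<close> divides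
      \<open>m\<close>, whose only prime factors are 2 and 3.\<close>
    have "p = 3"
    proof (rule ccontr)
      assume "p \<noteq> 3"
      have "k \<noteq> 0"
      proof
        assume "k = 0"
        then have "m + 1 = p" using p(4) prime_gt_0_nat[OF p(1)] by simp
        with not_prime p(1) show False by simp
      qed
      then have "p dvd m" using p(4) by simp
      then have "p dvd 2 \<or> p dvd 3 ^ j"
        unfolding m_def using p(1) by (simp add: prime_dvd_mult_iff)
      then have "p dvd 2 \<or> p dvd 3" using p(1) prime_dvd_power by blast
      then have "p = 2 \<or> p = 3"
        using p(1) by (auto simp: primes_dvd_imp_eq)
      with \<open>p \<noteq> 3\<close> p(2) show False by auto
    qed
    then show ?thesis using p(3,4) by (simp add: m_def)
  qed
  have "x \<in> {3 ^ Suc j, 2 * 3 ^ Suc j}" if "x \<in> totient_fibre m" for x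
  proof (cases "even x")
    case True
    have x: "x > 0" "totient x = m" using that by (auto simp: totient_fibre_def)
    from even_part_decomposition[OF x(1) True] obtain k y where
      *: "odd y" "x = 2 ^ Suc k * y" "totient x = 2 ^ k * totient y" .
    \<comment> \<open>For positive \<open>k\<close>, an odd part other than 1 makes 4 divide
      \<open>m\<close>, and odd part 1 makes \<open>m\<close> a power of 2; both contradict that
      \<open>m\<close> exceeds 2 and is not divisible by 4.\<close>
    have "k = 0"
    proof (rule ccontr)
      assume "k \<noteq> 0"
      then obtain i where i: "k = Suc i" by (cases k) auto
      have "y = 1"
      proof (rule ccontr)
        assume "y \<noteq> 1"
        then have "2 * 2 dvd 2 ^ k * totient y"
          using totient_odd_even[OF *(1)] i by (intro mult_dvd_mono) auto
        then show False using m4 x(2) *(3) by simp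
      qed
      then have "m = 2 ^ Suc i" using * x i by simp
      with m4 m2 show False by (cases i) auto
    qed
    then show ?thesis using odd_case[of y] * x by simp
  next
    case False
    then show ?thesis using odd_case[of x] that by (auto simp: totient_fibre_def)
  qed
  moreover have "totient (3 ^ Suc j) = m"
    using totient_prime_power_Suc[of 3 j] by (simp add: m_def)
  then have "3 ^ Suc j \<in> totient_fibre m" "2 * 3 ^ Suc j \<in> totient_fibre m"
    using totient_double[of "3 ^ Suc j"] by (auto simp: totient_fibre_def)
  ultimately have "totient_fibre m = {3 ^ Suc j, 2 * 3 ^ Suc j}" by blast
  moreover have "Suc j = 6 * t + 8" by (simp add: j_def)
  ultimately show ?thesis by (simp only: m_def j_def)
qed

lemma two_times_power_three_family:
  shows "2 * 3 ^ (6 * t + 7) \<in> totient_values"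
    and "N2 (2 * 3 ^ (6 * t + 7)) = 2 * 3 ^ (6 * t + 8)"
    and "N3 (2 * 3 ^ (6 * t + 7)) = 3 ^ (6 * t + 8)"
proof -
  have "3 ^ (6 * t + 8) \<in> totient_fibre (2 * 3 ^ (6 * t + 7))"
    by (simp only: fibre_two_times_power_three insertI1)
  then show "2 * 3 ^ (6 * t + 7) \<in> totient_values"
    unfolding totient_fibre_def totient_values_def by (metis (mono_tags, lifting) mem_Collect_eq imageI)
  show "N2 (2 * 3 ^ (6 * t + 7)) = 2 * 3 ^ (6 * t + 8)"
    by (simp add: N2_def fibre_two_times_power_three max_def del: power_Suc)
  show "N3 (2 * 3 ^ (6 * t + 7)) = 3 ^ (6 * t + 8)"
    by (simp add: N3_def fibre_two_times_power_three min_def del: power_Suc)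
qed

lemma infinite_ratio_two:
  "infinite {m \<in> totient_values. real (N2 m) / real (N3 m) = 2}"
proof (rule infinite_super)
  show "range (\<lambda>t. 2 * 3 ^ (6 * t + 7)) \<subseteq> {m \<in> totient_values. real (N2 m) / real (N3 m) = 2}"
    using two_times_power_three_family by auto
  have "inj (\<lambda>t. 2 * 3 ^ (6 * t + 7) :: nat)"
    by (rule injI) (simp del: power_Suc)
  then show "infinite (range (\<lambda>t. 2 * 3 ^ (6 * t + 7) :: nat))"
    by (rule range_inj_infinite)
qed

text \<open>Writing 3^(6t+8) as 3^8 * (3^6)^t turns the fixed step in the exponent into a fixed
  ratio. First term and ratio stay schematic until the \<open>show\<close> instantiates
  them.\<close>

lemma geometric_progression_N2:
  "contains_infinite_geometric_progression (N2 ` totient_values)"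
  unfolding contains_infinite_geometric_progression_def
proof (intro exI conjI allI)
  fix t :: nat
  have "2 * 3 ^ 8 * (3 ^ 6) ^ t = N2 (2 * 3 ^ (6 * t + 7))"
    unfolding two_times_power_three_family unfolding power_add power_mult
    by (simp only: mult_ac)
  then show "2 * 3 ^ 8 * (3 ^ 6) ^ t \<in> N2 ` totient_values"
    using two_times_power_three_family(1) by (metis imageI)
qed simp_all

lemma geometric_progression_N3:
  "contains_infinite_geometric_progression (N3 ` totient_values)"
  unfolding contains_infinite_geometric_progression_def
proof (intro exI conjI allI)
  fix t :: nat
  have "3 ^ 8 * (3 ^ 6) ^ t = N3 (2 * 3 ^ (6 * t + 7))"
    unfolding two_times_power_three_family unfolding power_add power_mult
    by (simp only: mult_ac)
  then show "3 ^ 8 * (3 ^ 6) ^ t \<in> N3 ` totient_values"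
    using two_times_power_three_family(1) by (metis imageI)
qed simp_all

section \<open>The ratio of the extremes and the final assembly\<close>

lemma N2_over_N3_bounds:
  assumes "m \<in> totient_values" "even m" "\<not> 4 dvd m"
  shows "2 \<le> real (N2 m) / real (N3 m)" "real (N2 m) / real (N3 m) \<le> 3"
proof -
  have m8: "\<not> 8 dvd m" using assms(3) by presburger
  have le: "2 * N3 m \<le> N2 m" by (rule N2_ge_twice_N3) (use assms m8 in auto)
  have gt: "m < N3 m" by (rule N_bounds) (use assms m8 in auto)
  \<comment> \<open>Comparing both extremes with \<open>m\<close> suffices for the upper bound:
    \<open>N2 m\<close> is at most 3m, and \<open>m\<close> lies below \<open>N3 m\<close>.\<close>
  have "N2 m \<le> 3 * m"
    using N2_in_fibre[OF assms(1) m8] le_three_times_totient[of "N2 m"] assms(3)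
    by (auto simp: totient_fibre_def)
  with gt have "N2 m \<le> 3 * N3 m" by linarith
  then have "real (N2 m) \<le> 3 * real (N3 m)" by linarith
  moreover have "2 * real (N3 m) \<le> real (N2 m)" using le by linarith
  ultimately show "2 \<le> real (N2 m) / real (N3 m)" "real (N2 m) / real (N3 m) \<le> 3"
    using gt by (simp_all add: le_divide_eq divide_le_eq)
qed

theorem theorem1p6:
  shows "(\<forall>m\<in>totient_values. [m = 2] (mod 4) \<or> [m = 4] (mod 8) \<longrightarrow>
            m < N3 m \<and> N3 m < 2 * m \<and> 2 * m < N2 m \<and> N2 m < 4 * m)
       \<and> (infinite {m \<in> totient_values. real (N2 m) / real (N3 m) = 2}
          \<and> (\<forall>m\<in>totient_values. [m = 2] (mod 4) \<longrightarrow>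
               2 \<le> real (N2 m) / real (N3 m) \<and> real (N2 m) / real (N3 m) \<le> 3))
       \<and> (contains_infinite_geometric_progression (N2 ` totient_values)
          \<and> contains_infinite_geometric_progression (N3 ` totient_values))"
proof (intro conjI ballI impI)
  fix m assume m: "m \<in> totient_values" and "[m = 2] (mod 4) \<or> [m = 4] (mod 8)"
  then have "m mod 4 = 2 \<or> m mod 8 = 4" unfolding cong_def by simp
  then have "even m" "\<not> 8 dvd m" by presburger+
  then show "m < N3 m" "N3 m < 2 * m" "2 * m < N2 m" "N2 m < 4 * m"
    using N_bounds[OF m] by blast+
next
  fix m assume m: "m \<in> totient_values" and "[m = 2] (mod 4)"
  then have "m mod 4 = 2" unfolding cong_def by simp
  then have "even m" "\<not> 4 dvd m" by presburger+
  then show "2 \<le> real (N2 m) / real (N3 m)" "real (N2 m) / real (N3 m) \<le> 3"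
    using N2_over_N3_bounds[OF m] by blast+
qed (rule infinite_ratio_two geometric_progression_N2 geometric_progression_N3)+

end
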